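(* Let $K\subset\mathbb{R}^p$ be a convex cone, let $\bar A$ be a $p\times p$ positive semidefinite matrix with largest and second largest eigenvalues $\lambda,\mu$ and eigengap $\nu=\lambda-\mu$, and let $\bar x\in K\cap\mathbb{S}^{p-1}$ be a first principal eigenvector of $\bar A$ (a unit eigenvector for $\lambda$). Let $A=\bar A+E$ be positive semidefinite. Apply to $A$ the cone projected power iteration $$v_{s}=\frac{\Pi_K A v_{s-1}}{\|\Pi_K A v_{s-1}\|},\qquad s\ge1,$$ with initial vector $v_0$, stopped as soon as $\|v_{s}-v_{s-1}\|\le\Delta$, and let $v_t$ be the output vector (the last iterate computed). Suppose that the initial vector satisfies $v_0^\top\bar x\ge c_0>c_{-1}$, and assume further that $\nu\ge(3+2\sqrt2)\|E\|_K$. If the stopping criterion satisfies $$\Delta\le\min\left\{\frac{5\|E\|_{\mathcal{T}_K(\bar x)}}{4(c_0\wedge c_1)\nu},\ \frac{4\|E\|_{\mathcal{T}_K(\bar x)}^2}{(c_0\wedge c_1)\lambda\nu},\ \frac{\|E\|_K}{2\lambda},\ 1\right\},$$ then $$\|v_t-\bar x\|\wedge\|v_t+\bar x\|\le\sqrt{\frac{8\|E\|_K}{(c_0\wedge c_1)\nu}}\wedge\frac{41\|E\|_{\mathcal{T}_K(\bar x)}}{(c_0\wedge c_1)\nu}.$$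
   Context: $\|\cdot\|$ is the Euclidean norm, $\mathbb{S}^{p-1}$ the unit sphere of $\mathbb{R}^p$, and $a\wedge b=\min(a,b)$. $\Pi_K v=\arg\min_{x\in K}\|v-x\|$. For a cone $C\subset\mathbb{R}^p$, $\|E\|_C=\sup_{x,y\in C\cap\mathbb{S}^{p-1}}|x^\top E y|$. The tangent cone of $K$ at $\bar x$ is $\mathcal{T}_K(\bar x)=\{t(v-\bar x): t\ge 0,\ v\in K\}$. The constants $c_{-1},c_1$ are $$c_\eta=\frac{\nu-\|E\|_K+\eta\sqrt{(\nu-\|E\|_K)^2-4\nu\|E\|_K}}{2\nu},\qquad \eta\in\{-1,1\},$$ which are well defined when $\nu\ge(3+2\sqrt2)\|E\|_K$.
   Formalization: The initial vector v_0 is additionally required to lie in K and have unit norm; without this the claim fails (e.g. a v_0 outside K can be sent to the second eigenvector while ‖E‖_K = 0). The eigengap ν is taken positive and p ≥ 2. *)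

theory Defs
  imports "HOL-Analysis.Analysis" "HOL-Library.Multiset"
begin

definition psd_matrix :: "real^'n^'n \<Rightarrow> bool" where
  "psd_matrix A \<longleftrightarrow> transpose A = A \<and> (\<forall>x. 0 \<le> x \<bullet> (A *v x))"

definition eigenspace :: "real^'n^'n \<Rightarrow> real \<Rightarrow> (real^'n) set" where
  "eigenspace A c = {x. A *v x = c *\<^sub>R x}"

definition eigenvalues :: "real^'n^'n \<Rightarrow> real set" where
  "eigenvalues A = {c. \<exists>x. x \<noteq> 0 \<and> x \<in> eigenspace A c}"

(* The real eigenvalues in decreasing order, each repeated according to its geometric
   multiplicity; only applied to symmetric matrices, where geometric and algebraic
   multiplicities agree and the list has length CARD('n). *)
definition eigenvalue_list :: "real^'n^'n \<Rightarrow> real list" where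
  "eigenvalue_list A =
     rev (sorted_list_of_multiset
       (\<Sum>c\<in>eigenvalues A. replicate_mset (dim (eigenspace A c)) c))"

definition cone_norm :: "(real^'n) set \<Rightarrow> real^'n^'n \<Rightarrow> real" where
  "cone_norm C E = (SUP (x, y) \<in> (C \<inter> sphere 0 1) \<times> (C \<inter> sphere 0 1). \<bar>x \<bullet> (E *v y)\<bar>)"

definition tangent_cone :: "(real^'n) set \<Rightarrow> real^'n \<Rightarrow> (real^'n) set" where
  "tangent_cone K x = {t *\<^sub>R (v - x) |t v. 0 \<le> t \<and> v \<in> K}"

definition c_const :: "real \<Rightarrow> real \<Rightarrow> real \<Rightarrow> real" where
  "c_const \<eta> \<nu> e = (\<nu> - e + \<eta> * sqrt ((\<nu> - e)\<^sup>2 - 4 * \<nu> * e)) / (2 * \<nu>)"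

(* "u is the projection of w onto K". A relation rather than a function, because K is not
   assumed to be closed, so that a minimiser need not exist for every w; by convexity of K
   there is at most one. *)
definition is_projection :: "(real^'n) set \<Rightarrow> real^'n \<Rightarrow> real^'n \<Rightarrow> bool" where
  "is_projection K w u \<longleftrightarrow> is_arg_min (\<lambda>x. norm (w - x)) (\<lambda>x. x \<in> K) u"

(* v 0, ..., v t are the iterates of the cone projected power iteration for A started at v 0,
   and t is the first index at least 1 at which the stopping criterion holds. *)
definition cone_power_run ::
  "(real^'n) set \<Rightarrow> real^'n^'n \<Rightarrow> real \<Rightarrow> (nat \<Rightarrow> real^'n) \<Rightarrow> nat \<Rightarrow> bool" where
  "cone_power_run K A \<Delta> v t \<longleftrightarrow>
     1 \<le> t \<and>
     (\<forall>s\<in>{1..t}. \<exists>u. is_projection K (A *v v (s - 1)) u \<and> v s = u /\<^sub>R norm u) \<and>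
     (\<forall>s\<in>{1..<t}. \<not> norm (v s - v (s - 1)) \<le> \<Delta>) \<and>
     norm (v t - v (t - 1)) \<le> \<Delta>"

end

theory Submission
  imports Defs
begin

text \<open>
  If \<open>v'\<close> is the normalised projection of \<open>A v\<close> onto \<open>K\<close>, then Moreau's conditions read
  \<open>k \<bullet> A v \<le> (v' \<bullet> A v) (k \<bullet> v')\<close> for all \<open>k \<in> K\<close>. Everything comes from this inequality at
  \<open>k = xbar\<close>. First, with \<open>a = v \<bullet> xbar\<close> and \<open>a' = v' \<bullet> xbar\<close> and the eigengap, it gives
  \<open>\<lambda> a - e \<le> (\<mu> + \<nu> a a' + e) a'\<close>, where \<open>e\<close> is the cone norm of \<open>E\<close> on \<open>K\<close>; hence the bound
  \<open>a \<ge> min c0 c1\<close> propagates, as the quadratic with roots \<open>cm1\<close> and \<open>c1\<close> is nonpositive at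
  \<open>min c0 c1\<close>. Second, once \<open>v\<close> and \<open>v'\<close> are \<open>\<Delta>\<close>-close, it reads
  \<open>xbar \<bullet> A v - a' (v' \<bullet> A v) \<le> 0\<close> with \<open>v\<close> replaceable by \<open>v'\<close> in the \<open>Abar\<close> part, at a cost
  of \<open>\<lambda> \<Delta>\<close>. Bounding the \<open>E\<close> part by the norm on \<open>K\<close> gives the square root rate. Writing
  \<open>v' = a' xbar + p\<close> with \<open>p\<close> in the tangent cone and bounding the \<open>E\<close> part there gains
  a factor \<open>norm p\<close>, which gives the linear rate.
\<close>

section \<open>Projection onto a convex cone\<close>

text \<open>Moreau's conditions, obtained by comparing \<open>u\<close> to first order with
  competitors \<open>u + s k\<close> that stay in \<open>K\<close>.\<close>

lemma convex_cone_projection: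
  assumes K: "convex_cone K" and u: "is_projection K w u"
  shows "u \<in> K" "(w - u) \<bullet> u = 0" "\<And>k. k \<in> K \<Longrightarrow> (w - u) \<bullet> k \<le> 0"
proof -
  have uK: "u \<in> K" and min: "\<And>x. x \<in> K \<Longrightarrow> norm (w - u) \<le> norm (w - x)"
    using u by (auto simp: is_projection_def is_arg_min_def not_less)
  show "u \<in> K" by (rule uK)
  have quad: "2 * s * ((w - u) \<bullet> k) \<le> s\<^sup>2 * (k \<bullet> k)" if "u + s *\<^sub>R k \<in> K" for s k
  proof -
    have "(norm (w - u))\<^sup>2 \<le> (norm (w - u - s *\<^sub>R k))\<^sup>2"
      using min[OF that] by (simp add: power_mono algebra_simps)
    then show ?thesis
      unfolding power2_norm_eq_inner
      by (simp add: inner_diff_left inner_diff_right inner_commute algebra_simps power2_eq_square)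
  qed
  have lin: "b \<le> 0" if "\<And>s. 0 < s \<Longrightarrow> s \<le> 1 \<Longrightarrow> 2 * s * b \<le> s\<^sup>2 * c" for b c :: real
  proof (rule ccontr)
    assume "\<not> b \<le> 0"
    then have b: "b > 0" by simp
    \<comment> \<open>Small enough that \<open>s * c\<close> cannot reach \<open>2 * b\<close>; the
      \<open>+ 1\<close> keeps the denominator positive when \<open>c = 0\<close>.\<close>
    define s where "s = min 1 (b / (\<bar>c\<bar> + 1))"
    have s: "0 < s" "s \<le> 1" "s \<le> b / (\<bar>c\<bar> + 1)" using b by (auto simp: s_def)
    have "2 * b \<le> s * c" using that[OF s(1,2)] s(1) by (simp add: power2_eq_square)
    also have "\<dots> \<le> s * (\<bar>c\<bar> + 1)" using s(1) by (intro mult_left_mono) auto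
    also have "\<dots> \<le> b" using s(3) by (simp add: field_simps)
    finally show False using b by simp
  qed
  have add: "\<And>x y. x \<in> K \<Longrightarrow> y \<in> K \<Longrightarrow> x + y \<in> K" and
    scale: "\<And>x s. x \<in> K \<Longrightarrow> 0 \<le> s \<Longrightarrow> s *\<^sub>R x \<in> K"
    using K by (auto simp: convex_cone_add convex_cone_scaleR)
  show le: "(w - u) \<bullet> k \<le> 0" if "k \<in> K" for k
    by (rule lin[of _ "k \<bullet> k"], rule quad, intro add uK scale that) simp
  \<comment> \<open>For \<open>s \<le> 1\<close> the competitor \<open>(1 - s) u\<close> is still in
    \<open>K\<close>, so the direction \<open>u\<close> may also be taken with the opposite
    sign.\<close>
  have "- ((w - u) \<bullet> u) \<le> 0"
  proof (rule lin[of _ "u \<bullet> u"])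
    fix s :: real assume s: "0 < s" "s \<le> 1"
    have "u + (- s) *\<^sub>R u = (1 - s) *\<^sub>R u" by (simp add: algebra_simps)
    also have "\<dots> \<in> K" using s by (intro scale uK) auto
    finally show "2 * s * - ((w - u) \<bullet> u) \<le> s\<^sup>2 * (u \<bullet> u)" using quad[of "- s" u] by simp
  qed
  with le[OF uK] show "(w - u) \<bullet> u = 0" by simp
qed

text \<open>The test vector \<open>k0\<close> excludes \<open>u = 0\<close>, for which the division
  would return 0. Moreau's conditions then give \<open>v \<bullet> w = norm u\<close>, so
  \<open>v \<bullet> w\<close> stands for the normalising factor.\<close>

lemma normalised_projection:
  assumes K: "convex_cone K" and u: "is_projection K w u" and v: "v = u /\<^sub>R norm u"
    and k0: "k0 \<in> K" "0 < k0 \<bullet> w"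
  shows "v \<in> K \<inter> sphere 0 1" "0 \<le> v \<bullet> w" "\<And>k. k \<in> K \<Longrightarrow> k \<bullet> w \<le> (v \<bullet> w) * (k \<bullet> v)"
proof -
  note P = convex_cone_projection[OF K u]
  have "u \<noteq> 0" using P(3)[OF k0(1)] k0(2) by (auto simp: inner_commute)
  then have nz: "norm u > 0" by simp
  have "u \<bullet> w = u \<bullet> u" using P(2) by (simp add: inner_diff_left inner_commute[of w])
  then have "u \<bullet> w = norm u * norm u" by (simp add: dot_square_norm power2_eq_square)
  then have vw: "v \<bullet> w = norm u" using nz by (simp add: v field_simps)
  show "v \<in> K \<inter> sphere 0 1"
    using nz convex_cone_scaleR[OF K _ P(1), of "inverse (norm u)"] by (auto simp: v)
  show "0 \<le> v \<bullet> w" by (simp add: vw)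
  show "k \<bullet> w \<le> (v \<bullet> w) * (k \<bullet> v)" if "k \<in> K" for k
  proof -
    have "k \<bullet> w \<le> k \<bullet> u" using P(3)[OF that] by (simp add: inner_diff_right inner_commute[of _ k])
    also have "\<dots> = norm u * (k \<bullet> v)" using nz by (simp add: v)
    finally show ?thesis by (simp add: vw)
  qed
qed

section \<open>Cone norms and the tangent cone\<close>

text \<open>A real supremum is an upper bound only for a set bounded above; the operator norm of
  \<open>E\<close> supplies the bound.\<close>

lemma cone_norm_upper:
  fixes E :: "real^'n^'n"
  assumes "x \<in> C \<inter> sphere 0 1" "y \<in> C \<inter> sphere 0 1"
  shows "\<bar>x \<bullet> (E *v y)\<bar> \<le> cone_norm C E"
proof -
  have "\<bar>p \<bullet> (E *v q)\<bar> \<le> onorm ((*v) E)" if "norm p = 1" "norm q = 1" for p q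
    using Cauchy_Schwarz_ineq2[of p "E *v q"] onorm[OF matrix_vector_mul_bounded_linear, of E q]
      that by auto
  then have "bdd_above ((\<lambda>(x, y). \<bar>x \<bullet> (E *v y)\<bar>) ` ((C \<inter> sphere 0 1) \<times> (C \<inter> sphere 0 1)))"
    by (intro bdd_aboveI[where M = "onorm ((*v) E)"]) auto
  from cSUP_upper[OF _ this, of "(x, y)"] show ?thesis
    using assms by (simp add: cone_norm_def)
qed

lemma cone_norm_nonneg:
  assumes "C \<inter> sphere 0 1 \<noteq> {}"
  shows "0 \<le> cone_norm C E"
proof -
  obtain x where "x \<in> C \<inter> sphere 0 1" using assms by blast
  from cone_norm_upper[OF this this, of E] show ?thesis by linarith
qed

lemma cone_norm_mono:
  assumes "C \<subseteq> D" "C \<inter> sphere 0 1 \<noteq> {}"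
  shows "cone_norm C E \<le> cone_norm D E"
  unfolding cone_norm_def[of C]
  using assms by (intro cSUP_least) (auto intro!: cone_norm_upper)

text \<open>Homogeneity. On the tangent cone this is the source of the extra factor
  \<open>norm p\<close>.\<close>

lemma conic_cone_norm_bound:
  assumes C: "conic C" and x: "x \<in> C" and y: "y \<in> C"
  shows "\<bar>x \<bullet> (E *v y)\<bar> \<le> cone_norm C E * norm x * norm y"
proof (cases "x = 0 \<or> y = 0")
  case False
  define x' y' where "x' = x /\<^sub>R norm x" and "y' = y /\<^sub>R norm y"
  have "x' \<in> C \<inter> sphere 0 1" "y' \<in> C \<inter> sphere 0 1"
    using C x y False by (auto simp: x'_def y'_def conic_def)
  then have "\<bar>x' \<bullet> (E *v y')\<bar> \<le> cone_norm C E" by (rule cone_norm_upper)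
  then have "norm x * norm y * \<bar>x' \<bullet> (E *v y')\<bar> \<le> norm x * norm y * cone_norm C E"
    by (intro mult_left_mono) auto
  also have "norm x * norm y * \<bar>x' \<bullet> (E *v y')\<bar> = \<bar>x \<bullet> (E *v y)\<bar>"
    using False by (simp add: x'_def y'_def matrix_vector_mult_scaleR abs_mult field_simps)
  finally show ?thesis by (simp add: mult_ac)
qed auto

lemma conic_tangent_cone: "conic (tangent_cone K x)"
  unfolding conic_def tangent_cone_def
  by clarsimp (metis mult_nonneg_nonneg scaleR_scaleR)

text \<open>With \<open>s = 0\<close> this places \<open>K\<close> in the tangent cone; with
  \<open>s\<close> the overlap of an iterate with a unit vector \<open>x\<close>, it places there
  the part of the iterate orthogonal to \<open>x\<close>.\<close>

lemma diff_scaleR_in_tangent_cone: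
  assumes K: "convex_cone K" and "x \<in> K" "z \<in> K" "0 \<le> s"
  shows "z - s *\<^sub>R x \<in> tangent_cone K x"
proof -
  \<comment> \<open>The shift by 1 keeps the factor positive when \<open>s = 0\<close>.\<close>
  define y where "y = (z + x) /\<^sub>R (s + 1)"
  have "y \<in> K"
    unfolding y_def using assms by (intro convex_cone_scaleR convex_cone_add) auto
  moreover have "z - s *\<^sub>R x = (s + 1) *\<^sub>R (y - x)"
  proof -
    have "(s + 1) *\<^sub>R y = z + x" using \<open>0 \<le> s\<close> by (simp add: y_def)
    then show ?thesis by (simp add: scaleR_right_diff_distrib scaleR_left_distrib)
  qed
  ultimately show ?thesis
    unfolding tangent_cone_def using \<open>0 \<le> s\<close> by (intro CollectI exI[of _ "s + 1"] exI[of _ y]) auto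
qed

lemma convex_cone_subset_tangent_cone:
  assumes "convex_cone K" "x \<in> K"
  shows "K \<subseteq> tangent_cone K x"
  using diff_scaleR_in_tangent_cone[OF assms, of _ 0] by auto

section \<open>Spectral meaning of the second entry of the eigenvalue list\<close>

lemma symmetric_inner_commute:
  fixes A :: "real^'n^'n"
  assumes "transpose A = A"
  shows "x \<bullet> (A *v y) = y \<bullet> (A *v x)"
  using assms by (metis dot_lmul_matrix inner_commute transpose_matrix_vector)

text \<open>A maximiser \<open>y\<close> of the Rayleigh quotient on the unit sphere of
  \<open>W\<close> is an eigenvector: its residual lies in \<open>W\<close>, and a small step along
  a nonzero residual, of suitable sign, would increase the quotient.\<close>

lemma symmetric_invariant_eigenvector:
  fixes A :: "real^'n^'n"
  assumes sym: "transpose A = A" and W: "subspace W" "W \<noteq> {0}"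
    and inv: "\<And>x. x \<in> W \<Longrightarrow> A *v x \<in> W"
  obtains m y where "y \<in> W" "norm y = 1" "A *v y = m *\<^sub>R y"
    "\<And>x. x \<in> W \<Longrightarrow> x \<bullet> (A *v x) \<le> m * (norm x)\<^sup>2"
proof -
  obtain w where w: "w \<in> W" "w \<noteq> 0" using W subspace_0 by blast
  then have "w /\<^sub>R norm w \<in> W \<inter> sphere 0 1" using W by (auto intro: subspace_scale)
  then have ne: "W \<inter> sphere 0 1 \<noteq> {}" by blast
  have "compact (W \<inter> sphere 0 1)" using W(1) by (intro closed_Int_compact closed_subspace) auto
  moreover have "continuous_on (W \<inter> sphere 0 1) (\<lambda>x. x \<bullet> (A *v x))"
    by (intro continuous_intros)
  ultimately obtain y where "y \<in> W \<inter> sphere 0 1"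
    and "\<forall>x \<in> W \<inter> sphere 0 1. x \<bullet> (A *v x) \<le> y \<bullet> (A *v y)"
    using continuous_attains_sup[OF _ ne] by blast
  then have y: "y \<in> W" "norm y = 1"
    and max: "\<And>x. x \<in> W \<Longrightarrow> norm x = 1 \<Longrightarrow> x \<bullet> (A *v x) \<le> y \<bullet> (A *v y)"
    by auto
  define m where "m = y \<bullet> (A *v y)"
  have le: "x \<bullet> (A *v x) \<le> m * (norm x)\<^sup>2" if "x \<in> W" for x
  proof (cases "x = 0")
    case False
    have "(x /\<^sub>R norm x) \<bullet> (A *v (x /\<^sub>R norm x)) \<le> m"
      unfolding m_def using False W that by (intro max) (auto intro: subspace_scale)
    then show ?thesis
      using False by (simp add: matrix_vector_mult_scaleR field_simps power2_eq_square)
  qed auto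
  define z where "z = m *\<^sub>R y - A *v y"
  have z: "z \<in> W" using y W inv by (auto simp: z_def intro: subspace_diff subspace_scale)
  \<comment> \<open>Maximality tested at \<open>y + s z\<close>: the constant terms cancel, and the
    definition of \<open>z\<close> turns the linear term into
    \<open>2 s (z \<bullet> z)\<close>.\<close>
  have q: "0 \<le> 2 * s * (z \<bullet> z) + s\<^sup>2 * (m * (norm z)\<^sup>2 - z \<bullet> (A *v z))" for s
  proof -
    have "y + s *\<^sub>R z \<in> W" using y z W by (auto intro: subspace_add subspace_scale)
    from le[OF this]
    have 1: "(y + s *\<^sub>R z) \<bullet> (A *v (y + s *\<^sub>R z)) \<le> m * ((y + s *\<^sub>R z) \<bullet> (y + s *\<^sub>R z))"
      by (simp add: power2_norm_eq_inner)
    have 2: "(y + s *\<^sub>R z) \<bullet> (A *v (y + s *\<^sub>R z))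
        = m + 2 * s * (z \<bullet> (A *v y)) + s\<^sup>2 * (z \<bullet> (A *v z))"
      using symmetric_inner_commute[OF sym, of y z]
      by (simp add: m_def matrix_vector_right_distrib matrix_vector_mult_scaleR inner_add_left
          inner_add_right power2_eq_square algebra_simps)
    have 3: "(y + s *\<^sub>R z) \<bullet> (y + s *\<^sub>R z) = 1 + 2 * s * (z \<bullet> y) + s\<^sup>2 * (z \<bullet> z)"
      using y(2) by (simp add: inner_add_left inner_add_right inner_commute power2_eq_square
          norm_eq_1 algebra_simps)
    have "z \<bullet> z = m * (z \<bullet> y) - z \<bullet> (A *v y)"
      by (subst (2) z_def) (simp add: inner_diff_right)
    then have "2 * s * (z \<bullet> z) = 2 * s * (m * (z \<bullet> y) - z \<bullet> (A *v y))" by (rule arg_cong)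
    then show ?thesis
      using 1 unfolding 2 3 power2_norm_eq_inner by (simp add: algebra_simps)
  qed
  define D where "D = m * (norm z)\<^sup>2 - z \<bullet> (A *v z)"
  have D: "D \<ge> 0" using le[OF z] by (simp add: D_def)
  have "z = 0"
  proof (rule ccontr)
    assume "z \<noteq> 0"
    then have pos: "z \<bullet> z > 0" by simp
    \<comment> \<open>Keeps \<open>s * D\<close> below \<open>z \<bullet> z\<close>, whereas
      \<open>q\<close> at \<open>- s\<close> demands at least
      \<open>2 * (z \<bullet> z)\<close>.\<close>
    define s where "s = (z \<bullet> z) / (D + 1)"
    have s: "s > 0" "s * (D + 1) = z \<bullet> z" using pos D by (auto simp: s_def)
    have "0 \<le> s * (s * D - 2 * (z \<bullet> z))"
      using q[of "- s"] by (simp add: D_def power2_eq_square algebra_simps)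
    then have "2 * (z \<bullet> z) \<le> s * D" using s(1) by (simp add: zero_le_mult_iff)
    then show False using s pos by (simp add: algebra_simps)
  qed
  then have "A *v y = m *\<^sub>R y" by (simp add: z_def)
  then show thesis using that y le by blast
qed

text \<open>Eigenvectors for distinct eigenvalues are orthogonal, hence independent. Finiteness
  matters because a sum over an infinite index set is 0, which would make
  \<open>eigenvalue_list\<close> empty.\<close>

lemma finite_eigenvalues:
  fixes A :: "real^'n^'n"
  assumes sym: "transpose A = A"
  shows "finite (eigenvalues A)"
proof -
  have "\<forall>c\<in>eigenvalues A. \<exists>x. x \<noteq> 0 \<and> A *v x = c *\<^sub>R x"
    by (auto simp: eigenvalues_def eigenspace_def)
  then obtain f where f: "\<And>c. c \<in> eigenvalues A \<Longrightarrow> f c \<noteq> 0 \<and> A *v f c = c *\<^sub>R f c" by metis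
  have orth: "f c \<bullet> f d = 0" if "c \<in> eigenvalues A" "d \<in> eigenvalues A" "c \<noteq> d" for c d
    using symmetric_inner_commute[OF sym, of "f c" "f d"] f that by (simp add: inner_commute)
  have inj: "inj_on f (eigenvalues A)"
    by (rule inj_onI) (metis f orth inner_eq_zero_iff)
  have "pairwise orthogonal (f ` eigenvalues A)" "0 \<notin> f ` eigenvalues A"
    using f orth by (auto simp: pairwise_def orthogonal_def)
  then have "independent (f ` eigenvalues A)" by (rule pairwise_orthogonal_independent)
  then have "finite (f ` eigenvalues A)" by (rule finiteI_independent)
  then show ?thesis using inj by (rule finite_imageD)
qed

lemma mset_eigenvalue_list_count:
  fixes A :: "real^'n^'n"
  assumes sym: "transpose A = A" and c: "c \<in> eigenvalues A"
  shows "count (mset (eigenvalue_list A)) c = dim (eigenspace A c)"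
  using finite_eigenvalues[OF sym] c
  by (simp add: eigenvalue_list_def count_sum)

lemma subspace_eigenspace: "subspace (eigenspace A c)"
  by (auto simp: subspace_def eigenspace_def matrix_vector_right_distrib
      matrix_vector_mult_scaleR scaleR_right_distrib)

text \<open>Multiset inclusion counts \<open>a\<close> and \<open>b\<close> separately even when
  they are equal, so the head accounts for at most one of them; the other lies in the tail, whose
  largest entry is \<open>xs ! 1\<close>.\<close>

lemma sorted_second_ge:
  fixes a b :: "'a::linorder"
  assumes "sorted_wrt (\<ge>) xs" "{#a, b#} \<subseteq># mset xs"
  shows "min a b \<le> xs ! 1"
proof -
  obtain x y zs where xs: "xs = x # y # zs"
    using size_mset_mono[OF assms(2)] by (cases xs; cases "tl xs") auto
  have top: "c \<le> y" if "c \<in># mset (y # zs)" for c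
    using that assms(1) by (auto simp: xs)
  show ?thesis
  proof (cases "a = x")
    case True
    then have "b \<in># mset (y # zs)"
      using assms(2) by (auto simp: xs dest: mset_subset_eqD)
    then show ?thesis using top by (force simp: xs min_le_iff_disj)
  next
    case False
    then have "a \<in># mset (y # zs)"
      using mset_subset_eqD[OF assms(2), of a] by (auto simp: xs)
    then show ?thesis using top by (force simp: xs min_le_iff_disj)
  qed
qed

text \<open>The hyperplane orthogonal to \<open>z\<close> is invariant; the top eigenvalue
  \<open>m\<close> of \<open>A\<close> there occurs in the list in addition to \<open>lam\<close>,
  so it is at most \<open>mu\<close>.\<close>

lemma eigengap_orthogonal_bound:
  fixes A :: "real^'n^'n"
  assumes n: "CARD('n) \<ge> 2" and psd: "psd_matrix A"
    and lam: "lam = eigenvalue_list A ! 0" and mu: "mu = eigenvalue_list A ! 1"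
    and z: "norm z = 1" "z \<in> eigenspace A lam"
  shows "0 \<le> mu" "\<And>x. x \<bullet> z = 0 \<Longrightarrow> x \<bullet> (A *v x) \<le> mu * (norm x)\<^sup>2"
proof -
  have sym: "transpose A = A" using psd by (simp add: psd_matrix_def)
  have Az: "A *v z = lam *\<^sub>R z" using z(2) by (simp add: eigenspace_def)
  define W where "W = {x. z \<bullet> x = 0}"
  have W: "subspace W" unfolding W_def by (rule subspace_hyperplane)
  have "dim W = CARD('n) - 1" using z(1) dim_hyperplane[of z] by (force simp: W_def)
  then have ne: "W \<noteq> {0}" using n by auto
  have inv: "A *v x \<in> W" if "x \<in> W" for x
    using symmetric_inner_commute[OF sym, of z x] that by (simp add: W_def Az inner_commute)
  obtain m y where y: "y \<in> W" "norm y = 1" "A *v y = m *\<^sub>R y"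
    and ray: "\<And>x. x \<in> W \<Longrightarrow> x \<bullet> (A *v x) \<le> m * (norm x)\<^sup>2"
    using symmetric_invariant_eigenvector[OF sym W ne inv] by metis
  have nz: "z \<noteq> 0" "y \<noteq> 0" using z y by auto
  have ev: "lam \<in> eigenvalues A" "m \<in> eigenvalues A"
    using nz y z by (auto simp: eigenvalues_def eigenspace_def)
  let ?xs = "eigenvalue_list A"
  have dimpos: "dim (eigenspace A c) \<ge> 1" if "c \<in> eigenvalues A" for c
    using that subspace_0[OF subspace_eigenspace, of A c]
    by (auto simp: eigenvalues_def Suc_le_eq zero_less_iff_neq_zero)
  have cnt: "count (mset ?xs) c \<ge> 1" if "c \<in> eigenvalues A" for c
    using dimpos[OF that] mset_eigenvalue_list_count[OF sym that] by simp
  have srt: "sorted_wrt (\<ge>) ?xs"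
    by (simp add: eigenvalue_list_def sorted_wrt_rev)
  have "m \<in> set ?xs" using cnt[OF ev(2)]
    by (metis count_eq_zero_iff not_one_le_zero set_mset_mset)
  then have mlam: "m \<le> lam" using srt unfolding lam by (cases ?xs) auto
  have "{#lam, m#} \<subseteq># mset ?xs"
  proof (cases "m = lam")
    \<comment> \<open>Here \<open>lam\<close> must occur twice: the orthogonal vectors
      \<open>y\<close> and \<open>z\<close> make its eigenspace at least two-dimensional.\<close>
    case True
    have yz: "y \<noteq> z" "y \<bullet> z = 0" using y z by (auto simp: W_def inner_commute)
    have "independent {y, z}"
      using nz yz by (intro pairwise_orthogonal_independent)
        (auto simp: pairwise_def orthogonal_def inner_commute)
    moreover have "{y, z} \<subseteq> eigenspace A lam" using y z True by (auto simp: eigenspace_def)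
    ultimately have "card {y, z} \<le> dim (eigenspace A lam)" by (intro independent_card_le_dim) auto
    then show ?thesis
      using mset_eigenvalue_list_count[OF sym ev(1)] True yz
      by (auto simp: subseteq_mset_def)
  next
    case False
    then show ?thesis using cnt[OF ev(1)] cnt[OF ev(2)] by (auto simp: subseteq_mset_def)
  qed
  from sorted_second_ge[OF srt this] have mmu: "m \<le> mu" using mlam by (simp add: mu)
  have "0 \<le> y \<bullet> (A *v y)" using psd by (simp add: psd_matrix_def)
  then have "0 \<le> m" using y by (simp add: norm_eq_1)
  with mmu show "0 \<le> mu" by simp
  show "x \<bullet> (A *v x) \<le> mu * (norm x)\<^sup>2" if "x \<bullet> z = 0" for x
  proof -
    have "x \<bullet> (A *v x) \<le> m * (norm x)\<^sup>2" using that by (intro ray) (simp add: W_def inner_commute)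
    also have "\<dots> \<le> mu * (norm x)\<^sup>2" using mmu by (intro mult_right_mono) auto
    finally show ?thesis .
  qed
qed

section \<open>Bilinear bounds for positive semidefinite matrices\<close>

text \<open>Nonnegativity of the quadratic form at \<open>x - y\<close>.\<close>

lemma psd_inner_le_mean:
  fixes A :: "real^'n^'n"
  assumes "psd_matrix A"
  shows "x \<bullet> (A *v y) \<le> (x \<bullet> (A *v x) + y \<bullet> (A *v y)) / 2"
proof -
  have "0 \<le> (x - y) \<bullet> (A *v (x - y))" using assms by (simp add: psd_matrix_def)
  then show ?thesis
    using symmetric_inner_commute[of A y x] assms
    by (simp add: psd_matrix_def matrix_vector_mult_diff_distrib inner_diff_left inner_diff_right)
qed

text \<open>The mean bound for the two normalised vectors, scaled back.\<close>

lemma psd_inner_le: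
  fixes A :: "real^'n^'n"
  assumes psd: "psd_matrix A" and L: "\<And>x. x \<bullet> (A *v x) \<le> L * (norm x)\<^sup>2"
  shows "x \<bullet> (A *v y) \<le> L * norm x * norm y"
proof (cases "x = 0 \<or> y = 0")
  case False
  define x' y' where "x' = x /\<^sub>R norm x" and "y' = y /\<^sub>R norm y"
  have "x' \<bullet> (A *v y') \<le> L"
    using psd_inner_le_mean[OF psd, of x' y'] L[of x'] L[of y'] False by (simp add: x'_def y'_def)
  then have "norm x * norm y * (x' \<bullet> (A *v y')) \<le> norm x * norm y * L"
    by (intro mult_left_mono) auto
  also have "norm x * norm y * (x' \<bullet> (A *v y')) = x \<bullet> (A *v y)"
    using False by (simp add: x'_def y'_def matrix_vector_mult_scaleR field_simps)
  finally show ?thesis by (simp add: mult_ac)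
qed auto

text \<open>The line through \<open>z\<close> and its orthogonal complement are both invariant under
  \<open>A\<close>, so there are no cross terms.\<close>

lemma eigengap_inner_split:
  fixes A :: "real^'n^'n"
  assumes psd: "psd_matrix A" and z: "norm z = 1" "A *v z = lam *\<^sub>R z"
  shows "x \<bullet> (A *v y) = lam * (x \<bullet> z) * (y \<bullet> z)
    + (x - (x \<bullet> z) *\<^sub>R z) \<bullet> (A *v (y - (y \<bullet> z) *\<^sub>R z))"
proof -
  have "transpose A = A" using psd by (simp add: psd_matrix_def)
  then have "z \<bullet> (A *v y) = lam * (y \<bullet> z)"
    using symmetric_inner_commute[of A z y] z by simp
  then show ?thesis
    using z by (simp add: matrix_vector_mult_diff_distrib matrix_vector_mult_scaleR
        inner_diff_left inner_diff_right norm_eq_1 algebra_simps)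
qed

lemma orthogonal_part:
  fixes x z :: "'a::real_inner"
  assumes "norm z = 1"
  shows "(x - (x \<bullet> z) *\<^sub>R z) \<bullet> z = 0"
    and "(norm (x - (x \<bullet> z) *\<^sub>R z))\<^sup>2 = (norm x)\<^sup>2 - (x \<bullet> z)\<^sup>2"
  using assms unfolding power2_norm_eq_inner
  by (simp_all add: inner_diff_left inner_diff_right norm_eq_1 inner_commute power2_eq_square)

text \<open>The parts orthogonal to \<open>z\<close> contribute at most \<open>mu\<close> times the
  mean of their squared norms; the inequality between arithmetic and geometric means then leaves the
  product of the overlaps with coefficient \<open>lam - mu\<close>.\<close>

lemma eigengap_inner_le:
  fixes A :: "real^'n^'n"
  assumes psd: "psd_matrix A" and z: "norm z = 1" "A *v z = lam *\<^sub>R z" and mu: "0 \<le> mu"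
    and gap: "\<And>x. x \<bullet> z = 0 \<Longrightarrow> x \<bullet> (A *v x) \<le> mu * (norm x)\<^sup>2"
    and xy: "norm x = 1" "norm y = 1"
  shows "x \<bullet> (A *v y) \<le> mu + (lam - mu) * (x \<bullet> z) * (y \<bullet> z)"
proof -
  define p q where "p = x - (x \<bullet> z) *\<^sub>R z" and "q = y - (y \<bullet> z) *\<^sub>R z"
  note o = orthogonal_part[OF z(1)]
  have "p \<bullet> (A *v q) \<le> (mu * (norm p)\<^sup>2 + mu * (norm q)\<^sup>2) / 2"
    using psd_inner_le_mean[OF psd, of p q] gap[of p] gap[of q] o(1) by (simp add: p_def q_def)
  also have "\<dots> = mu - mu * ((x \<bullet> z)\<^sup>2 + (y \<bullet> z)\<^sup>2) / 2"
    using xy by (simp add: p_def q_def o(2) field_simps)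
  also have "\<dots> \<le> mu - mu * ((x \<bullet> z) * (y \<bullet> z))"
    using mult_left_mono[OF sum_squares_bound[of "x \<bullet> z" "y \<bullet> z"] mu] by (simp add: algebra_simps)
  finally show ?thesis
    using eigengap_inner_split[OF psd z, of x y, folded p_def q_def] by (simp add: algebra_simps)
qed

lemma eigengap_quadratic_le:
  fixes A :: "real^'n^'n"
  assumes psd: "psd_matrix A" and z: "norm z = 1" "A *v z = lam *\<^sub>R z" and mu: "mu \<le> lam"
    and gap: "\<And>x. x \<bullet> z = 0 \<Longrightarrow> x \<bullet> (A *v x) \<le> mu * (norm x)\<^sup>2"
  shows "x \<bullet> (A *v x) \<le> lam * (norm x)\<^sup>2"
proof -
  define p where "p = x - (x \<bullet> z) *\<^sub>R z"
  note o = orthogonal_part[OF z(1), of x, folded p_def]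
  have "x \<bullet> (A *v x) \<le> lam * (x \<bullet> z)\<^sup>2 + mu * ((norm x)\<^sup>2 - (x \<bullet> z)\<^sup>2)"
    using eigengap_inner_split[OF psd z, of x x, folded p_def] gap[OF o(1)] o(2)
    by (simp add: power2_eq_square)
  also have "mu * ((norm x)\<^sup>2 - (x \<bullet> z)\<^sup>2) \<le> lam * ((norm x)\<^sup>2 - (x \<bullet> z)\<^sup>2)"
    using mu o(2) zero_le_power2[of "norm p"] by (intro mult_right_mono) auto
  finally show ?thesis by (simp add: algebra_simps)
qed

section \<open>The scalar recursion for the overlap\<close>

text \<open>The two constants are the roots of \<open>nu * x^2 - (nu - e) * x + e\<close>. The
  minimum lies between them, where this quadratic is nonpositive.\<close>

lemma c_const_between:
  assumes nu: "0 < nu" and e: "0 \<le> e" and gap: "nu \<ge> (3 + 2 * sqrt 2) * e"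
    and c: "c_const (-1) nu e < c0"
  shows "0 < min c0 (c_const 1 nu e)"
    and "nu * (min c0 (c_const 1 nu e))\<^sup>2 + e \<le> (nu - e) * min c0 (c_const 1 nu e)"
proof -
  define d where "d = (nu - e)\<^sup>2 - 4 * nu * e"
  have s2: "(sqrt 2)\<^sup>2 = (2::real)" by simp
  have "(3 - 2 * sqrt 2) * e \<le> (3 + 2 * sqrt 2) * e" using e by (intro mult_right_mono) auto
  \<comment> \<open>The discriminant factors in this way, which explains the constant
    \<open>3 + 2 * sqrt 2\<close>.\<close>
  then have "0 \<le> (nu - (3 + 2 * sqrt 2) * e) * (nu - (3 - 2 * sqrt 2) * e)"
    using gap by (intro mult_nonneg_nonneg) auto
  also have "\<dots> = d" using s2 by (simp add: d_def algebra_simps power2_eq_square)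
  finally have d: "0 \<le> d" .
  have "(3 + 2 * sqrt 2) * e \<ge> 3 * e" using e by (intro mult_right_mono) auto
  then have ne: "nu - e > 0" using gap nu e by linarith
  have "sqrt d \<le> sqrt ((nu - e)\<^sup>2)" using nu e by (intro real_sqrt_le_mono) (simp add: d_def)
  \<comment> \<open>The second bound makes the smaller root nonnegative, hence \<open>c0\<close>
    positive.\<close>
  then have sd: "0 \<le> sqrt d" "sqrt d \<le> nu - e" using ne d by auto
  let ?m = "c_const (-1) nu e" and ?p = "c_const 1 nu e"
  have mp: "?m = (nu - e - sqrt d) / (2 * nu)" "?p = (nu - e + sqrt d) / (2 * nu)"
    by (simp_all add: c_const_def d_def)
  have m: "0 \<le> ?m" "?m \<le> ?p" "0 < ?p"
    using nu ne sd by (auto simp: mp intro!: divide_right_mono divide_pos_pos add_pos_nonneg)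
  show "0 < min c0 ?p" using m c by simp
  define c' where "c' = min c0 ?p"
  have "(c' - ?m) * (c' - ?p) \<le> 0"
    using m c by (intro mult_nonneg_nonpos) (auto simp: c'_def)
  then have "nu * ((c' - ?m) * (c' - ?p)) \<le> 0" using nu by (simp add: mult_nonneg_nonpos)
  also have "nu * ((c' - ?m) * (c' - ?p)) = nu * c'\<^sup>2 - nu * (?m + ?p) * c' + nu * (?m * ?p)"
    by (simp add: algebra_simps power2_eq_square)
  also have "nu * (?m + ?p) = nu - e" using nu by (simp add: mp field_simps)
  also have "nu * (?m * ?p) = e"
  proof -
    have "nu * (?m * ?p) = ((nu - e)\<^sup>2 - (sqrt d)\<^sup>2) / (4 * nu)"
      using nu by (simp add: mp field_simps power2_eq_square)
    also have "\<dots> = e" using nu d by (simp add: d_def)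
    finally show ?thesis .
  qed
  finally show "nu * (min c0 ?p)\<^sup>2 + e \<le> (nu - e) * min c0 ?p" by (simp add: c'_def)
qed

text \<open>Here \<open>mu + nu\<close> is the top eigenvalue. If \<open>a' < c\<close>,
  monotonicity allows \<open>c\<close> to replace first \<open>a'\<close> and then \<open>a\<close>
  in \<open>step\<close>, and the result contradicts \<open>quad\<close>.\<close>

lemma overlap_recursion:
  fixes a a' c :: real
  assumes nu: "0 < nu" and mu: "0 \<le> mu" and e: "0 \<le> e" and c: "0 < c" "c \<le> 1"
    and quad: "nu * c\<^sup>2 + e \<le> (nu - e) * c"
    and a: "c \<le> a" and a': "0 < a'"
    and step: "(mu + nu) * a - e \<le> (mu + nu * a * a' + e) * a'"
  shows "c \<le> a'"
proof (rule ccontr)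
  assume "\<not> c \<le> a'"
  then have lt: "a' < c" by simp
  have a0: "0 < a" using a c by simp
  have "nu * a * (a' * a') < nu * a * (c * c)"
    using nu a0 a' lt c by (intro mult_strict_left_mono mult_strict_mono) auto
  moreover have "(mu + e) * a' \<le> (mu + e) * c" using mu e lt by (intro mult_left_mono) auto
  ultimately have "(mu + nu) * a - e < nu * a * (c * c) + (mu + e) * c"
    using step by (simp add: algebra_simps)
  \<comment> \<open>Once the terms in \<open>a\<close> are collected, their slope is nonnegative
    because \<open>c \<le> 1\<close>, so \<open>a\<close> may be lowered to
    \<open>c\<close>.\<close>
  moreover have "(mu + nu - nu * c * c) * c \<le> (mu + nu - nu * c * c) * a"
  proof (intro mult_left_mono a)
    have "c * c \<le> 1" using c by (simp add: mult_le_one)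
    then have "nu * (c * c) \<le> nu * 1" using nu by (intro mult_left_mono) auto
    then show "0 \<le> mu + nu - nu * c * c" using mu by (simp add: mult.assoc)
  qed
  \<comment> \<open>Trades the cubic term left by both replacements for the square in
    \<open>quad\<close>.\<close>
  moreover have "nu * (c * c * c) \<le> nu * (c * c)"
    using nu c by (intro mult_left_mono) (auto intro: mult_left_le)
  ultimately show False using quad by (simp add: power2_eq_square algebra_simps)
qed

section \<open>One step of the iteration, and the stopped iterate\<close>

context
  fixes K :: "(real^'n) set" and Abar E :: "real^'n^'n" and z :: "real^'n" and lam mu nu c :: real
  assumes K: "convex_cone K" and psd: "psd_matrix Abar"
    and z: "z \<in> K" "norm z = 1" "Abar *v z = lam *\<^sub>R z"
    and mu: "0 \<le> mu" and nu: "nu = lam - mu" "0 < nu"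
    and gap: "\<And>x. x \<bullet> z = 0 \<Longrightarrow> x \<bullet> (Abar *v x) \<le> mu * (norm x)\<^sup>2"
    and c: "0 < c" "c \<le> 1" and quad: "nu * c\<^sup>2 + cone_norm K E \<le> (nu - cone_norm K E) * c"
begin

lemma inner_perturbed_top:
  "x \<bullet> ((Abar + E) *v y) = x \<bullet> (Abar *v y) + x \<bullet> (E *v y)"
  "z \<bullet> ((Abar + E) *v y) = lam * (y \<bullet> z) + z \<bullet> (E *v y)"
proof -
  show *: "x \<bullet> ((Abar + E) *v y) = x \<bullet> (Abar *v y) + x \<bullet> (E *v y)" for x
    by (simp add: matrix_vector_mult_add_rdistrib inner_add_right)
  show "z \<bullet> ((Abar + E) *v y) = lam * (y \<bullet> z) + z \<bullet> (E *v y)"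
    using symmetric_inner_commute[of Abar z y] psd z(3) by (simp add: * psd_matrix_def)
qed

lemma cone_norm_K_nonneg: "0 \<le> cone_norm K E"
  using z by (intro cone_norm_nonneg) auto

text \<open>\<open>quad\<close> forces \<open>cone_norm K E < nu * c\<close>, so the perturbation
  cannot cancel the overlap with \<open>z\<close>. The projection is therefore nonzero, and Moreau's
  inequality at \<open>z\<close> feeds \<open>overlap_recursion\<close>.\<close>

lemma cone_power_step:
  assumes v: "v \<in> K \<inter> sphere 0 1" "c \<le> v \<bullet> z"
    and u: "is_projection K ((Abar + E) *v v) u" and v': "v' = u /\<^sub>R norm u"
  shows "v' \<in> K \<inter> sphere 0 1" "c \<le> v' \<bullet> z"
    "z \<bullet> ((Abar + E) *v v) \<le> (v' \<bullet> ((Abar + E) *v v)) * (v' \<bullet> z)"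
proof -
  let ?e = "cone_norm K E" and ?w = "(Abar + E) *v v"
  note e = cone_norm_K_nonneg
  have zv: "lam * (v \<bullet> z) - ?e \<le> z \<bullet> ?w"
    using cone_norm_upper[of z K v E] z v by (auto simp: inner_perturbed_top(2))
  have "?e < nu * c"
  proof -
    have "0 \<le> ?e * c" "0 < nu * c\<^sup>2" using e c nu by auto
    then show ?thesis using quad by (simp add: algebra_simps)
  qed
  also have "nu * c \<le> lam * (v \<bullet> z)"
    using mu nu c v by (intro mult_mono) auto
  finally have pos: "0 < z \<bullet> ?w" using zv by simp
  note P = normalised_projection[OF K u v' z(1) pos]
  show v'K: "v' \<in> K \<inter> sphere 0 1" by (rule P(1))
  show zle: "z \<bullet> ?w \<le> (v' \<bullet> ?w) * (v' \<bullet> z)" using P(3)[OF z(1)] by (simp add: inner_commute)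
  \<comment> \<open>The product in \<open>zle\<close> is positive and its first factor is
    nonnegative.\<close>
  have a': "0 < v' \<bullet> z" using pos zle P(2) by (smt (verit) mult_nonneg_nonpos)
  have "v' \<bullet> ?w \<le> mu + nu * (v \<bullet> z) * (v' \<bullet> z) + ?e"
    using cone_norm_upper[OF v'K v(1), of E] eigengap_inner_le[OF psd z(2,3) mu gap, of v' v] v v'K
    by (auto simp: inner_perturbed_top(1) nu algebra_simps)
  then have "(v' \<bullet> ?w) * (v' \<bullet> z) \<le> (mu + nu * (v \<bullet> z) * (v' \<bullet> z) + ?e) * (v' \<bullet> z)"
    using a' by (intro mult_right_mono) auto
  then show "c \<le> v' \<bullet> z"
    using zv zle nu by (intro overlap_recursion[OF nu(2) mu e c quad v(2) a']) auto
qed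

lemma cone_power_iterates:
  assumes v0: "v 0 \<in> K \<inter> sphere 0 1" "c \<le> v 0 \<bullet> z"
    and run: "cone_power_run K (Abar + E) \<Delta> v t" and s: "s \<le> t"
  shows "v s \<in> K \<inter> sphere 0 1 \<and> c \<le> v s \<bullet> z"
  using s
proof (induction s)
  case (Suc s)
  have "Suc s \<in> {1..t}" using Suc.prems by simp
  then obtain u where "is_projection K ((Abar + E) *v v (Suc s - 1)) u" "v (Suc s) = u /\<^sub>R norm u"
    using run unfolding cone_power_run_def by blast
  then show ?case using cone_power_step(1,2)[of "v s" u "v (Suc s)"] Suc by auto
qed (use v0 in auto)

text \<open>The 3 is twice \<open>1 + 1/2\<close> and the 5 is twice \<open>2 + 1/2\<close>: the
  halves pay for replacing \<open>v\<close> by \<open>v'\<close> in the \<open>Abar\<close> part,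
  the rest for \<open>E\<close>.\<close>

lemma nearly_stationary_bounds:
  assumes v: "v \<in> K \<inter> sphere 0 1" and v': "v' \<in> K \<inter> sphere 0 1" "c \<le> v' \<bullet> z"
    and zle: "z \<bullet> ((Abar + E) *v v) \<le> (v' \<bullet> ((Abar + E) *v v)) * (v' \<bullet> z)"
    and near: "lam * norm (v' - v) \<le> cone_norm K E / 2"
  shows "norm (v' - z) \<le> sqrt (3 * cone_norm K E / (c * nu))"
    and "norm (v' - z) \<le> 5 * cone_norm (tangent_cone K z) E / (c * nu)"
proof -
  let ?e = "cone_norm K E" and ?T = "tangent_cone K z"
  define \<tau> where "\<tau> = cone_norm ?T E"
  define a where "a = v' \<bullet> z"
  note e = cone_norm_K_nonneg
  have KT: "K \<subseteq> ?T" by (rule convex_cone_subset_tangent_cone[OF K z(1)])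
  have e\<tau>: "?e \<le> \<tau>" unfolding \<tau>_def using z by (intro cone_norm_mono[OF KT]) auto
  have nv: "norm v = 1" "norm v' = 1" "v \<in> K" "v' \<in> K" using v v' by auto
  have a: "c \<le> a" "0 < a" "a \<le> 1"
    using v' c Cauchy_Schwarz_ineq2[of v' z] nv z(2) by (auto simp: a_def)
  have lam: "0 < lam" "mu \<le> lam" using nu mu by auto
  have AL: "x \<bullet> (Abar *v y) \<le> lam * norm x * norm y" for x y
    by (rule psd_inner_le[OF psd eigengap_quadratic_le[OF psd z(2,3) lam(2) gap]])
  have shift: "\<bar>x \<bullet> (Abar *v (v' - v))\<bar> \<le> (?e / 2) * norm x" for x
  proof -
    have "\<bar>x \<bullet> (Abar *v (v' - v))\<bar> \<le> norm x * (lam * norm (v' - v))"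
      using AL[of x "v' - v"] AL[of "- x" "v' - v"] by (simp add: mult_ac)
    also have "\<dots> \<le> norm x * (?e / 2)" by (intro mult_left_mono near) auto
    finally show ?thesis by (simp add: mult_ac)
  qed
  have split: "x \<bullet> (Abar *v v) = x \<bullet> (Abar *v v') - x \<bullet> (Abar *v (v' - v))" for x
    by (simp add: matrix_vector_mult_diff_distrib inner_diff_right)
  have nrm: "(norm (v' - z))\<^sup>2 = 2 * (1 - a)"
    using nv z by (simp add: a_def power2_norm_eq_inner inner_diff_left inner_diff_right
        norm_eq_1 inner_commute)
  have cnu: "0 < c * nu" using c nu by simp
  show "norm (v' - z) \<le> sqrt (3 * ?e / (c * nu))"
  proof (rule real_le_rsqrt)
    have "lam * a - 3 * ?e / 2 \<le> z \<bullet> ((Abar + E) *v v)"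
      using shift[of z] cone_norm_upper[of z K v E] z v inner_perturbed_top(2)[of v']
        inner_perturbed_top(1)[of z v'] inner_perturbed_top(1)[of z v] split[of z]
      by (auto simp: a_def)
    also note zle
    also have "(v' \<bullet> ((Abar + E) *v v)) * (v' \<bullet> z) \<le> (mu + nu * a * a + 3 * ?e / 2) * a"
      unfolding a_def[symmetric]
    proof (rule mult_right_mono)
      show "v' \<bullet> ((Abar + E) *v v) \<le> mu + nu * a * a + 3 * ?e / 2"
        using shift[of v'] cone_norm_upper[OF v'(1) v, of E] split[of v'] nv
          eigengap_inner_le[OF psd z(2,3) mu gap, of v' v']
        by (auto simp: inner_perturbed_top(1) a_def nu)
    qed (use a in auto)
    \<comment> \<open>The factor \<open>1 + a\<close> comes from \<open>1 - a^2\<close> on the left,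
      and on the right from adding the error \<open>3 * ?e / 2\<close> and \<open>a\<close> times
      it.\<close>
    finally have "(1 + a) * (nu * a * (1 - a)) \<le> (1 + a) * (3 * ?e / 2)"
      by (simp add: nu algebra_simps)
    then have "nu * a * (1 - a) \<le> 3 * ?e / 2" by (rule mult_left_le_imp_le) (use a in simp)
    moreover have "nu * c * (1 - a) \<le> nu * a * (1 - a)"
      using a nu by (intro mult_right_mono mult_left_mono) auto
    ultimately have "2 * (1 - a) * (c * nu) \<le> 3 * ?e" by (simp add: algebra_simps)
    then show "(norm (v' - z))\<^sup>2 \<le> 3 * ?e / (c * nu)"
      using cnu by (simp only: nrm pos_le_divide_eq)
  qed
  define p where "p = v' - a *\<^sub>R z"
  define b where "b = norm p"
  have pz: "p \<bullet> z = 0" and b2: "b\<^sup>2 = 1 - a\<^sup>2"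
    using orthogonal_part[OF z(2), of v'] nv by (simp_all add: p_def b_def a_def)
  have pT: "p \<in> ?T" unfolding p_def using a by (intro diff_scaleR_in_tangent_cone K z nv) auto
  have v'p: "v' = p + a *\<^sub>R z" by (simp add: p_def)
  have b: "0 \<le> b" "b \<le> 1"
    using b2 power2_le_imp_le[of b 1] by (auto simp: b_def)
  note \<tau>bd = conic_cone_norm_bound[OF conic_tangent_cone, of _ K z _ E, folded \<tau>_def]
  have "a * b * nu \<le> 5 / 2 * \<tau>"
  proof (cases "b = 0")
    case True
    then show ?thesis using e e\<tau> by simp
  next
    case False
    \<comment> \<open>Two forms of one vector. As \<open>z - a v'\<close> it turns
      \<open>zle\<close> into \<open>q \<bullet> ((Abar + E) *v v) \<le> 0\<close>; as
      \<open>b^2 z - a p\<close> it is a combination of tangent cone vectors in which each term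
      carries a factor \<open>b\<close>.\<close>
    define q where "q = b\<^sup>2 *\<^sub>R z - a *\<^sub>R p"
    have qz: "q = z - a *\<^sub>R v'"
      unfolding q_def b2 v'p by (simp add: power2_eq_square algebra_simps)
    have "(norm q)\<^sup>2 = b\<^sup>2"
      using nv z unfolding power2_norm_eq_inner qz b2
      by (simp add: inner_diff_left inner_diff_right norm_eq_1 inner_commute a_def power2_eq_square)
    then have nq: "norm q = b" using b by (simp add: power2_eq_iff_nonneg)
    have "q \<bullet> ((Abar + E) *v v) \<le> 0"
      using zle by (simp add: qz inner_diff_left a_def mult.commute)
    then have "q \<bullet> (Abar *v v') \<le> q \<bullet> (Abar *v (v' - v)) - q \<bullet> (E *v v)"
      using split[of q] by (simp add: inner_perturbed_top(1))
    also have "\<dots> \<le> (\<tau> / 2) * b + 2 * \<tau> * b"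
    proof -
      have "q \<bullet> (Abar *v (v' - v)) \<le> (?e / 2) * b" using shift[of q] nq by simp
      moreover have "(?e / 2) * b \<le> (\<tau> / 2) * b" using e\<tau> b by (intro mult_right_mono) auto
      moreover have "- (q \<bullet> (E *v v)) \<le> 2 * \<tau> * b"
      proof -
        have zT: "z \<in> ?T" and vT: "v \<in> ?T" using KT z nv by auto
        have 1: "b\<^sup>2 * \<bar>z \<bullet> (E *v v)\<bar> \<le> b\<^sup>2 * \<tau>"
          using \<tau>bd[OF zT vT] z nv by (intro mult_left_mono) auto
        have 2: "a * \<bar>p \<bullet> (E *v v)\<bar> \<le> a * (\<tau> * b)"
          using \<tau>bd[OF pT vT] nv a by (intro mult_left_mono) (auto simp: b_def)
        have "- (q \<bullet> (E *v v)) \<le> b\<^sup>2 * \<bar>z \<bullet> (E *v v)\<bar> + a * \<bar>p \<bullet> (E *v v)\<bar>"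
        proof -
          have "- (b\<^sup>2 * (z \<bullet> (E *v v))) \<le> b\<^sup>2 * \<bar>z \<bullet> (E *v v)\<bar>"
            by (metis abs_ge_minus_self abs_mult abs_power2)
          moreover have "a * (p \<bullet> (E *v v)) \<le> a * \<bar>p \<bullet> (E *v v)\<bar>"
            using a by (intro mult_left_mono) auto
          ultimately show ?thesis by (simp add: q_def inner_diff_left)
        qed
        also have "\<dots> \<le> b\<^sup>2 * \<tau> + a * (\<tau> * b)" using 1 2 by simp
        also have "\<dots> \<le> b * \<tau> + 1 * (\<tau> * b)"
          using a b e e\<tau> by (intro add_mono mult_right_mono)
            (auto simp: power2_eq_square mult_left_le)
        finally show ?thesis by (simp add: algebra_simps)
      qed
      ultimately show ?thesis by linarith
    qed
    finally have "q \<bullet> (Abar *v v') \<le> (5 / 2 * \<tau>) * b" by (simp add: algebra_simps)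
    \<comment> \<open>The component of \<open>q\<close> along \<open>z\<close> contributes exactly
      \<open>lam * a * b^2\<close>, and the one along \<open>p\<close> takes away at most
      \<open>mu * a * b^2\<close>.\<close>
    moreover have "a * b * nu * b \<le> q \<bullet> (Abar *v v')"
    proof -
      have "z \<bullet> (Abar *v v') = lam * a"
        using inner_perturbed_top(1)[of z v'] inner_perturbed_top(2)[of v'] by (simp add: a_def)
      moreover have "p \<bullet> (Abar *v v') = p \<bullet> (Abar *v p)"
        using pz z by (simp add: v'p matrix_vector_right_distrib matrix_vector_mult_scaleR
            inner_add_right)
      moreover have "a * (p \<bullet> (Abar *v p)) \<le> a * (mu * b\<^sup>2)"
        using gap[OF pz] a by (intro mult_left_mono) (auto simp: b_def)
      ultimately show ?thesis
        by (simp add: q_def inner_diff_left nu power2_eq_square algebra_simps)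
    qed
    ultimately have "(a * b * nu) * b \<le> (5 / 2 * \<tau>) * b" by simp
    then show ?thesis by (rule mult_right_le_imp_le) (use False b in simp)
  qed
  moreover have "c * b * nu \<le> a * b * nu" using a b nu by (intro mult_right_mono) auto
  ultimately have "2 * b \<le> 5 * \<tau> / (c * nu)" using cnu by (simp add: pos_le_divide_eq algebra_simps)
  \<comment> \<open>A crude bound: the squared distance \<open>2 * (1 - a)\<close> is already at
    most \<open>2 * b^2\<close>.\<close>
  moreover have "norm (v' - z) \<le> 2 * b"
  proof (rule power2_le_imp_le)
    have "a\<^sup>2 \<le> a" using a by (simp add: power2_eq_square mult_left_le)
    then have "1 - a \<le> b\<^sup>2" by (simp add: b2)
    then show "(norm (v' - z))\<^sup>2 \<le> (2 * b)\<^sup>2" using a by (simp add: nrm power_mult_distrib)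
  qed (use b in simp)
  ultimately show "norm (v' - z) \<le> 5 * cone_norm ?T E / (c * nu)" by (simp add: \<tau>_def)
qed

end

theorem theorem4p1:
  fixes K :: "(real^'n) set"
    and A Abar E :: "real^'n^'n"
    and xbar :: "real^'n"
    and v :: "nat \<Rightarrow> real^'n"
    and t :: nat
    and \<Delta> c0 lam mu nu c1 cm1 :: real
  assumes "CARD('n) \<ge> 2"
    and "convex_cone K"
    and "psd_matrix Abar"
    and "lam = eigenvalue_list Abar ! 0"
    and "mu = eigenvalue_list Abar ! 1"
    and "nu = lam - mu"
    and "nu > 0"
    and "xbar \<in> K \<inter> sphere 0 1"
    and "xbar \<in> eigenspace Abar lam"
    and "A = Abar + E"
    and "psd_matrix A"
    and "c1 = c_const 1 nu (cone_norm K E)"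
    and "cm1 = c_const (-1) nu (cone_norm K E)"
    and "v 0 \<in> K \<inter> sphere 0 1"
    and "cone_power_run K A \<Delta> v t"
    and "v 0 \<bullet> xbar \<ge> c0"
    and "c0 > cm1"
    and "nu \<ge> (3 + 2 * sqrt 2) * cone_norm K E"
    and "\<Delta> \<le> Min {5 * cone_norm (tangent_cone K xbar) E / (4 * min c0 c1 * nu),
                   4 * (cone_norm (tangent_cone K xbar) E)\<^sup>2 / (min c0 c1 * lam * nu),
                   cone_norm K E / (2 * lam),
                   1}"
  shows "min (norm (v t - xbar)) (norm (v t + xbar))
           \<le> min (sqrt (8 * cone_norm K E / (min c0 c1 * nu)))
                 (41 * cone_norm (tangent_cone K xbar) E / (min c0 c1 * nu))"
proof -
  define c where "c = min c0 c1"
  have x: "xbar \<in> K" "norm xbar = 1" "Abar *v xbar = lam *\<^sub>R xbar"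
    using assms(8,9) by (auto simp: eigenspace_def)
  note spec = eigengap_orthogonal_bound[OF assms(1,3,4,5) x(2) assms(9)]
  have e: "0 \<le> cone_norm K E" using assms(8) by (intro cone_norm_nonneg) auto
  have c: "0 < c" "nu * c\<^sup>2 + cone_norm K E \<le> (nu - cone_norm K E) * c"
    using c_const_between[OF assms(7) e assms(18), of c0] assms(12,13,17) by (auto simp: c_def)
  have "c \<le> v 0 \<bullet> xbar" using assms(16) by (simp add: c_def)
  \<comment> \<open>Gives \<open>c \<le> 1\<close>, on which the recursion relies.\<close>
  moreover have "v 0 \<bullet> xbar \<le> 1"
    using Cauchy_Schwarz_ineq2[of "v 0" xbar] assms(14) x(2) by auto
  ultimately have c1: "c \<le> 1" and cv: "c \<le> v 0 \<bullet> xbar" by auto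
  \<comment> \<open>The assumptions of the context above, in its order.\<close>
  note setting = assms(2,3) x spec(1) assms(6,7) spec(2) c(1) c1 c(2)
  have run: "cone_power_run K (Abar + E) \<Delta> v t" using assms(10,15) by simp
  have it: "v s \<in> K \<inter> sphere 0 1 \<and> c \<le> v s \<bullet> xbar" if "s \<le> t" for s
    by (rule cone_power_iterates[OF setting assms(14) cv run that])
  have t: "1 \<le> t" "norm (v t - v (t - 1)) \<le> \<Delta>" using run by (auto simp: cone_power_run_def)
  then obtain u where u: "is_projection K ((Abar + E) *v v (t - 1)) u" "v t = u /\<^sub>R norm u"
    using run unfolding cone_power_run_def by (metis atLeastAtMost_iff order_refl)
  have prev: "v (t - 1) \<in> K \<inter> sphere 0 1" "c \<le> v (t - 1) \<bullet> xbar" using it[of "t - 1"] by auto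
  have step: "xbar \<bullet> ((Abar + E) *v v (t - 1)) \<le> (v t \<bullet> ((Abar + E) *v v (t - 1))) * (v t \<bullet> xbar)"
    by (rule cone_power_step(3)[OF setting prev u])
  \<comment> \<open>The third entry of the minimum bounding \<open>\<Delta>\<close>.\<close>
  have "norm (v t - v (t - 1)) \<le> cone_norm K E / (2 * lam)" using t(2) assms(19) by simp
  then have near: "lam * norm (v t - v (t - 1)) \<le> cone_norm K E / 2"
    using spec(1) assms(6,7) by (simp add: field_simps)
  have final: "v t \<in> K \<inter> sphere 0 1" "c \<le> v t \<bullet> xbar" using it[of t] by auto
  note B = nearly_stationary_bounds[OF setting prev(1) final step near]
  have cnu: "0 < c * nu" using c assms(7) by simp
  have \<tau>: "cone_norm K E \<le> cone_norm (tangent_cone K xbar) E"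
    using assms(8) by (intro cone_norm_mono convex_cone_subset_tangent_cone assms(2) x) auto
  have "sqrt (3 * cone_norm K E / (c * nu)) \<le> sqrt (8 * cone_norm K E / (c * nu))"
    using cnu e by (intro real_sqrt_le_mono divide_right_mono) auto
  moreover have "5 * cone_norm (tangent_cone K xbar) E / (c * nu)
      \<le> 41 * cone_norm (tangent_cone K xbar) E / (c * nu)"
    using cnu e \<tau> by (intro divide_right_mono) auto
  \<comment> \<open>The overlap with \<open>xbar\<close> stays positive, so it is
    \<open>v t - xbar\<close>, the first entry of the left minimum, that is bounded.\<close>
  ultimately show ?thesis
    unfolding c_def[symmetric] using B by (intro min.coboundedI1 min.boundedI) linarith+
qed

end
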